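(* Let $\mathcal{A}\subseteq\mathbb{N}^n$ be a finite set, and let $\mathcal{B}$ be a monomial basis for $\mathcal{A}$. Let $\Sigma(\mathcal{A})$ be the set of polynomials supported on $\mathcal{A}$ that admit a positive semidefinite Gram matrix indexed by $\mathcal{B}$, and let $\Sigma_*(\mathcal{A})$ be the subset of those that admit a positive semidefinite Gram matrix whose sparsity pattern is given by the stabilized binary matrix $B_{\mathcal{A}}^{( * )}$. Then $\Sigma_*(\mathcal{A})=\Sigma(\mathcal{A})$.
   Context: $\mathbb{N}=\{0,1,2,\ldots\}$; $\mathbb{R}[\mathbf{x}]=\mathbb{R}[x_1,\ldots,x_n]$; $\mathbf{x}^{\alpha}=x_1^{\alpha_1}\cdots x_n^{\alpha_n}$. The support of $f=\sum_\alpha f_\alpha\mathbf{x}^\alpha$ is $\mathrm{supp}(f)=\{\alpha: f_\alpha\neq0\}$. For finite $\mathcal{A}\subseteq\mathbb{N}^n$, $\mathscr{P}(\mathcal{A})=\{f\in\mathbb{R}[\mathbf{x}]:\mathrm{supp}(f)\subseteq\mathcal{A}\}$. $\mathbb{N}^n_d=\{\alpha\in\mathbb{N}^n:\sum_i\alpha_i\le d\}$. Monomial basis: a finite set $\mathcal{B}\subseteq\mathbb{N}^n$ of exponents, which is either $\mathcal{B}=\frac12\mathrm{conv}(\mathcal{A})\cap\mathbb{N}^n$ (Newton polytope method) or the standard basis $\mathcal{B}=\mathbb{N}^n_d$ with $\mathcal{A}\subseteq\mathbb{N}^n_{2d}$. Put $r=|\mathcal{B}|$; $\mathbf{x}^{\mathcal{B}}$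 is the column vector of monomials $\mathbf{x}^\beta$, $\beta\in\mathcal{B}$; $r\times r$ matrices have rows and columns indexed by $\mathcal{B}$. $\mathbb{S}^r_+$ is the set of real symmetric positive semidefinite $r\times r$ matrices. For a symmetric binary ($\{0,1\}$-valued) matrix $B$, $\mathbb{S}^r_+(B)=\{Q\in\mathbb{S}^r_+: B\circ Q=Q\}$, where $\circ$ is the entrywise product. Block-closure: for a symmetric binary matrix $B$, $\overline{B}$ is the binary matrix whose set of positions of nonzero entries is the transitive closure of the relation $\{(i,j):B_{ij}=1\}$. Iteration: $\mathcal{S}^{(0)}=\mathcal{A}\cup 2\mathcal{B}$ with $2\mathcal{B}=\{2\beta:\beta\in\mathcal{B}\}$. For $k\ge1$: (1) $[C_{\mathcal{A}}^{(k)}]_{\beta\gamma}=1$ if $\beta+\gamma\in\mathcal{S}^{(k-1)}$ and $0$ otherwise ($\beta,\gamma\in\mathcal{B}$); (2) $B_{\mathcal{A}}^{(k)}=\overline{C_{\mathcal{A}}^{(k)}}$ and $\mathcal{S}^{(k)}=\{\beta+\gamma:[B_{\mathcal{A}}^{(k)}]_{\beta\gamma}=1\}$. The supports of $B_{\mathcal{A}}^{(k)}$ are nondecreasing in $k$, so the sequence is eventually constant; its eventual value is denoted $B_{\mathcal{A}}^{( * )}$. $\Sigma(\mathcal{A})=\{f\in\mathscr{P}(\mathcal{A}):\exists Q\in\mathbb{S}^r_+\text{ with }f=(\mathbf{x}^{\mathcal{B}})^TQ\mathbf{x}^{\mathcal{B}}\}$ and $\Sigma_*(\mathcal{A})=\{f\in\mathscr{P}(\mathcal{A}):\exists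 Q\in\mathbb{S}^r_+(B_{\mathcal{A}}^{( * )})\text{ with }f=(\mathbf{x}^{\mathcal{B}})^TQ\mathbf{x}^{\mathcal{B}}\}$. *)

theory Defs
  imports "HOL-Analysis.Analysis" "HOL-Library.Poly_Mapping"
begin

text \<open>
  Exponent vectors are elements of \<^typ>\<open>nat ^ 'n\<close>, and real polynomials in the variables indexed
  by the finite type \<^typ>\<open>'n\<close> are finitely supported maps from exponents to coefficients, with the
  convolution product of \<^theory>\<open>HOL-Library.Poly_Mapping\<close>. The support of \<open>f\<close> is \<open>keys f\<close>.
\<close>

type_synonym 'n expo = "nat ^ 'n"
type_synonym 'n mpoly = "(nat ^ 'n) \<Rightarrow>\<^sub>0 real"

definition monomial :: "'n::finite expo \<Rightarrow> 'n mpoly" where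
  "monomial \<alpha> = Poly_Mapping.single \<alpha> 1"

definition const_poly :: "real \<Rightarrow> 'n::finite mpoly" where
  "const_poly c = Poly_Mapping.single 0 c"

definition polys_on :: "'n::finite expo set \<Rightarrow> 'n mpoly set" where
  "polys_on A = {f. Poly_Mapping.keys f \<subseteq> A}"

definition real_expo :: "'n::finite expo \<Rightarrow> real ^ 'n" where
  "real_expo \<alpha> = (\<chi> i. real (\<alpha> $ i))"

definition standard_basis :: "nat \<Rightarrow> 'n::finite expo set" where
  "standard_basis d = {\<alpha>. (\<Sum>i\<in>UNIV. \<alpha> $ i) \<le> d}"

definition newton_basis :: "'n::finite expo set \<Rightarrow> 'n expo set" where
  "newton_basis A = {\<beta>. real_expo \<beta> \<in> (\<lambda>p. (1/2) *\<^sub>R p) ` (convex hull (real_expo ` A))}"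

definition monomial_basis :: "'n::finite expo set \<Rightarrow> 'n expo set \<Rightarrow> bool" where
  "monomial_basis A B \<longleftrightarrow> finite B \<and>
     (B = newton_basis A \<or> (\<exists>d. B = standard_basis d \<and> A \<subseteq> standard_basis (2 * d)))"

text \<open>
  A real matrix with rows and columns indexed by a finite set \<open>I\<close> is a function of two indices that
  vanishes outside \<open>I \<times> I\<close>, so that equality of such functions is equality of matrices.
\<close>

type_synonym 'i matrix = "'i \<Rightarrow> 'i \<Rightarrow> real"

definition matrices_on :: "'i set \<Rightarrow> 'i matrix set" where
  "matrices_on I = {Q. \<forall>i j. (i, j) \<notin> I \<times> I \<longrightarrow> Q i j = 0}"

definition psd_matrices :: "'i set \<Rightarrow> 'i matrix set" where
  "psd_matrices I = {Q \<in> matrices_on I.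
     (\<forall>i\<in>I. \<forall>j\<in>I. Q i j = Q j i) \<and>
     (\<forall>v :: 'i \<Rightarrow> real. (\<Sum>i\<in>I. \<Sum>j\<in>I. v i * Q i j * v j) \<ge> 0)}"

definition hadamard :: "'i matrix \<Rightarrow> 'i matrix \<Rightarrow> 'i matrix" where
  "hadamard P Q = (\<lambda>i j. P i j * Q i j)"

definition psd_matrices_pattern :: "'i set \<Rightarrow> 'i matrix \<Rightarrow> 'i matrix set" where
  "psd_matrices_pattern I P = {Q \<in> psd_matrices I. hadamard P Q = Q}"

definition block_closure :: "'i matrix \<Rightarrow> 'i matrix" where
  "block_closure P = (\<lambda>i j. of_bool ((i, j) \<in> {(i, j). P i j = 1}\<^sup>+))"

definition support_adjacency :: "'n::finite expo set \<Rightarrow> 'n expo set \<Rightarrow> 'n expo matrix" where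
  "support_adjacency B S = (\<lambda>\<beta> \<gamma>. of_bool (\<beta> \<in> B \<and> \<gamma> \<in> B \<and> \<beta> + \<gamma> \<in> S))"

fun S_iter :: "'n::finite expo set \<Rightarrow> 'n expo set \<Rightarrow> nat \<Rightarrow> 'n expo set" where
  "S_iter A B 0 = A \<union> (\<lambda>\<beta>. 2 *s \<beta>) ` B"
| "S_iter A B (Suc k) =
     {\<beta> + \<gamma> | \<beta> \<gamma>. \<beta> \<in> B \<and> \<gamma> \<in> B \<and>
        block_closure (support_adjacency B (S_iter A B k)) \<beta> \<gamma> = 1}"

text \<open>
  The matrix iterates are indexed from \<open>k = 1\<close>; the value at \<open>k = 0\<close> duplicates the one at \<open>k = 1\<close>
  and has no meaning.
\<close>

definition C_iter :: "'n::finite expo set \<Rightarrow> 'n expo set \<Rightarrow> nat \<Rightarrow> 'n expo matrix" where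
  "C_iter A B k = support_adjacency B (S_iter A B (k - 1))"

definition B_iter :: "'n::finite expo set \<Rightarrow> 'n expo set \<Rightarrow> nat \<Rightarrow> 'n expo matrix" where
  "B_iter A B k = block_closure (C_iter A B k)"

lemma S_iter_eq_B_iter:
  assumes "k \<ge> 1"
  shows "S_iter A B k = {\<beta> + \<gamma> | \<beta> \<gamma>. \<beta> \<in> B \<and> \<gamma> \<in> B \<and> B_iter A B k \<beta> \<gamma> = 1}"
  using assms by (cases k) (simp_all add: B_iter_def C_iter_def)

definition B_stable :: "'n::finite expo set \<Rightarrow> 'n expo set \<Rightarrow> 'n expo matrix" where
  "B_stable A B = (THE P. \<forall>\<^sub>F k in sequentially. B_iter A B k = P)"

text \<open>The description in \<open>B_stable\<close> is proper: the iterates are eventually constant.\<close>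

definition B_supp :: "'n::finite expo set \<Rightarrow> 'n expo set \<Rightarrow> nat \<Rightarrow> ('n expo \<times> 'n expo) set" where
  "B_supp A B k = {(\<beta>, \<gamma>). \<beta> \<in> B \<and> \<gamma> \<in> B \<and> \<beta> + \<gamma> \<in> S_iter A B k}\<^sup>+"

lemma B_iter_Suc: "B_iter A B (Suc k) = (\<lambda>\<beta> \<gamma>. of_bool ((\<beta>, \<gamma>) \<in> B_supp A B k))"
  by (simp add: B_iter_def C_iter_def block_closure_def support_adjacency_def B_supp_def)

lemma B_supp_subset: "B_supp A B k \<subseteq> B \<times> B"
  unfolding B_supp_def by (rule trancl_subset_Sigma) auto

lemma B_supp_mono: "B_supp A B k \<subseteq> B_supp A B (Suc k)"
proof -
  have "(\<beta>, \<gamma>) \<in> B_supp A B k" if "\<beta> \<in> B" "\<gamma> \<in> B" "\<beta> + \<gamma> \<in> S_iter A B k" for \<beta> \<gamma>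
    using that by (auto simp: B_supp_def)
  then have "\<beta> + \<gamma> \<in> S_iter A B (Suc k)" if "\<beta> \<in> B" "\<gamma> \<in> B" "\<beta> + \<gamma> \<in> S_iter A B k" for \<beta> \<gamma>
    using that B_iter_Suc[of A B k] by (fastforce simp: B_iter_def C_iter_def)
  then have sub: "{(\<beta>, \<gamma>). \<beta> \<in> B \<and> \<gamma> \<in> B \<and> \<beta> + \<gamma> \<in> S_iter A B k}
      \<subseteq> {(\<beta>, \<gamma>). \<beta> \<in> B \<and> \<gamma> \<in> B \<and> \<beta> + \<gamma> \<in> S_iter A B (Suc k)}" by blast
  show ?thesis
    unfolding B_supp_def using trancl_mono_subset[OF sub] .
qed

lemma B_stable_eventually:
  assumes "finite B"
  shows "\<forall>\<^sub>F k in sequentially. B_iter A B k = B_stable A B"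
proof -
  have inc: "incseq (B_supp A B)" by (rule incseq_SucI) (rule B_supp_mono)
  have "finite (range (B_supp A B))"
    by (rule finite_subset[of _ "Pow (B \<times> B)"]) (use assms B_supp_subset in auto)
  then obtain N where N: "\<And>k. k \<ge> N \<Longrightarrow> B_supp A B k = B_supp A B N"
  proof -
    let ?R = "range (B_supp A B)"
    obtain X where X: "X \<in> ?R" "\<And>Y. Y \<in> ?R \<Longrightarrow> X \<subseteq> Y \<Longrightarrow> X = Y"
      using finite_has_maximal[OF \<open>finite ?R\<close>] by auto
    then obtain N where "X = B_supp A B N" by auto
    with X inc have "\<And>k. k \<ge> N \<Longrightarrow> B_supp A B k = B_supp A B N"
      by (metis incseqD rangeI)
    then show ?thesis using that by blast
  qed
  have ev: "\<forall>\<^sub>F k in sequentially. B_iter A B k = B_iter A B (Suc N)"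
  proof (rule eventually_sequentiallyI)
    fix k assume "Suc N \<le> k"
    then obtain m where "k = Suc m" "m \<ge> N" by (cases k) auto
    then show "B_iter A B k = B_iter A B (Suc N)" using N[of m] by (simp add: B_iter_Suc)
  qed
  have "B_stable A B = B_iter A B (Suc N)"
    unfolding B_stable_def
  proof (rule the_equality)
    show "\<forall>\<^sub>F k in sequentially. B_iter A B k = B_iter A B (Suc N)" by (rule ev)
    fix P assume "\<forall>\<^sub>F k in sequentially. B_iter A B k = P"
    with ev have "\<forall>\<^sub>F k in sequentially. P = B_iter A B (Suc N)"
      by eventually_elim simp
    then show "P = B_iter A B (Suc N)" by simp
  qed
  with ev show ?thesis by simp
qed

definition gram_poly :: "'n::finite expo set \<Rightarrow> 'n expo matrix \<Rightarrow> 'n mpoly" where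
  "gram_poly B Q =
     (\<Sum>\<beta>\<in>B. \<Sum>\<gamma>\<in>B. monomial \<beta> * const_poly (Q \<beta> \<gamma>) * monomial \<gamma>)"

definition Sigma_full :: "'n::finite expo set \<Rightarrow> 'n expo set \<Rightarrow> 'n mpoly set" where
  "Sigma_full A B = {f \<in> polys_on A. \<exists>Q \<in> psd_matrices B. f = gram_poly B Q}"

definition Sigma_star :: "'n::finite expo set \<Rightarrow> 'n expo set \<Rightarrow> 'n mpoly set" where
  "Sigma_star A B =
     {f \<in> polys_on A. \<exists>Q \<in> psd_matrices_pattern B (B_stable A B). f = gram_poly B Q}"

end

theory Submission imports Defs begin

text \<open>
  Given a Gram matrix \<open>Q\<close> of \<open>f\<close>, erase the entries outside the pattern of \<open>B_stable A B\<close>. The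
  pattern is an equivalence relation \<open>R\<close> on \<open>B\<close>, so what remains is block diagonal with principal
  submatrices of \<open>Q\<close> as blocks, and hence positive semidefinite. The polynomial does not change:
  by stability \<open>R\<close> contains either all or none of the pairs with a given sum \<open>\<alpha>\<close>, and in the
  latter case either \<open>\<alpha>\<close> is not a sum of two elements of \<open>B\<close> or \<open>\<alpha>\<close> lies outside \<open>A\<close>, so that the
  erased entries already added up to \<open>0\<close>.
\<close>

text \<open>Reduces identities between Gram polynomials to coefficients: the one at \<alpha> only
  sees the entries of \<open>Q\<close> whose indices add up to \<alpha>.\<close>

lemma lookup_gram_poly:
  "Poly_Mapping.lookup (gram_poly B Q) \<alpha> =
     (\<Sum>\<beta>\<in>B. \<Sum>\<gamma>\<in>B. if \<beta> + \<gamma> = \<alpha> then Q \<beta> \<gamma> else 0)"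
  unfolding gram_poly_def monomial_def const_poly_def
  by (simp add: mult_single lookup_sum lookup_single when_def)

text \<open>The 0/1 matrix of an equivalence relation is the sum, over its classes \<open>X\<close>,
  of the rank-one matrices built from the indicator vector of \<open>X\<close>. The quadratic form
  of the masked matrix at \<open>v\<close> is therefore the sum of the values of the form of
  \<open>Q\<close> at the restrictions of \<open>v\<close> to the classes, each nonnegative.\<close>

lemma hadamard_equiv_psd:
  assumes "finite I" and R: "equiv I R" and Q: "Q \<in> psd_matrices I"
  shows "hadamard (\<lambda>i j. of_bool ((i, j) \<in> R)) Q \<in> psd_matrices I" (is "?H \<in> _")
proof -
  have fin: "finite (I // R)"
    using \<open>finite I\<close> R by (simp add: equiv_type finite_quotient)
  have pattern: "(of_bool ((i, j) \<in> R) :: real) = (\<Sum>X\<in>I // R. of_bool (i \<in> X) * of_bool (j \<in> X))"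
    if i: "i \<in> I" and j: "j \<in> I" for i j
  proof -
    \<comment> \<open>Exactly one class contains \<open>i\<close>, so the sum over classes collapses
      to a single term.\<close>
    have "i \<in> X \<longleftrightarrow> X = R `` {i}" if "X \<in> I // R" for X
      using that i R by (metis equiv_class_self in_quotient_imp_non_empty quotientI quotient_eqI
          quotientE Image_singleton_iff equiv_class_eq)
    then have "(\<Sum>X\<in>I // R. of_bool (i \<in> X) * of_bool (j \<in> X))
        = (\<Sum>X\<in>I // R. if X = R `` {i} then of_bool (j \<in> X) else (0::real))"
      by (intro sum.cong) auto
    also have "\<dots> = of_bool (j \<in> R `` {i})"
      using fin quotientI[OF i, of R] by simp
    finally show ?thesis by simp
  qed
  have "(\<Sum>i\<in>I. \<Sum>j\<in>I. v i * ?H i j * v j) \<ge> 0" for v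
  proof -
    have "(\<Sum>i\<in>I. \<Sum>j\<in>I. v i * ?H i j * v j) =
        (\<Sum>i\<in>I. \<Sum>j\<in>I. \<Sum>X\<in>I // R. (of_bool (i \<in> X) * v i) * Q i j * (of_bool (j \<in> X) * v j))"
      by (intro sum.cong refl)
        (simp add: hadamard_def pattern sum_distrib_left sum_distrib_right mult_ac del: of_bool_eq_iff)
    also have "\<dots> =
        (\<Sum>X\<in>I // R. \<Sum>i\<in>I. \<Sum>j\<in>I. (of_bool (i \<in> X) * v i) * Q i j * (of_bool (j \<in> X) * v j))"
      by (simp only: sum.swap[of _ "I // R" I])
    also have "\<dots> \<ge> 0"
    proof (rule sum_nonneg)
      fix X
      have "0 \<le> (\<Sum>i\<in>I. \<Sum>j\<in>I. w i * Q i j * w j)" for w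
        using Q by (simp add: psd_matrices_def)
      from this[of "\<lambda>i. of_bool (i \<in> X) * v i"]
      show "0 \<le> (\<Sum>i\<in>I. \<Sum>j\<in>I. (of_bool (i \<in> X) * v i) * Q i j * (of_bool (j \<in> X) * v j))" .
    qed
    finally show ?thesis .
  qed
  moreover have "(i, j) \<in> R \<longleftrightarrow> (j, i) \<in> R" for i j
    using R by (meson equivE symE)
  ultimately show ?thesis
    using Q by (auto simp: psd_matrices_def matrices_on_def hadamard_def)
qed

lemma S_iter_Suc: "S_iter A B (Suc k) = {\<beta> + \<gamma> | \<beta> \<gamma>. (\<beta>, \<gamma>) \<in> B_supp A B k}"
  using B_supp_subset[of A B k] B_iter_Suc[of A B k]
  by (fastforce simp: B_iter_def C_iter_def)

lemma B_suppI: "\<lbrakk>\<beta> \<in> B; \<gamma> \<in> B; \<beta> + \<gamma> \<in> S_iter A B k\<rbrakk> \<Longrightarrow> (\<beta>, \<gamma>) \<in> B_supp A B k"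
  by (auto simp: B_supp_def)

lemma B_supp_0_subset: "B_supp A B 0 \<subseteq> B_supp A B k"
  using lift_Suc_mono_le[of "B_supp A B" 0 k] B_supp_mono by blast

text \<open>Reflexivity is the reason for putting the doubled exponents into
  \<open>S_iter A B 0\<close>: they give the diagonal at index 0, and monotonicity keeps it.
  Symmetry comes from commutativity of addition and survives transitive closure.\<close>

lemma B_supp_equiv: "equiv B (B_supp A B k)"
proof (rule equivI)
  show "B_supp A B k \<subseteq> B \<times> B" by (rule B_supp_subset)
  have "(\<beta>, \<beta>) \<in> B_supp A B 0" if "\<beta> \<in> B" for \<beta>
  proof (rule B_suppI)
    have "\<beta> + \<beta> = 2 *s \<beta>" by (simp add: vec_eq_iff)
    with that show "\<beta> + \<beta> \<in> S_iter A B 0" by auto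
  qed (use that in auto)
  moreover have "B_supp A B 0 \<subseteq> B_supp A B k" by (rule B_supp_0_subset)
  ultimately show "refl_on B (B_supp A B k)" by (auto simp: refl_on_def)
  show "sym (B_supp A B k)"
    unfolding B_supp_def by (rule sym_trancl) (auto simp: sym_def add.commute)
  show "trans (B_supp A B k)" by (simp add: B_supp_def)
qed

lemma B_stable_obtain_equiv:
  fixes A B :: "(nat ^ 'n::finite) set"
  assumes "finite B"
  obtains R where "B_stable A B = (\<lambda>\<beta> \<gamma>. of_bool ((\<beta>, \<gamma>) \<in> R))"
    and "equiv B R"
    and "\<And>\<beta> \<gamma>. \<lbrakk>\<beta> \<in> B; \<gamma> \<in> B; \<beta> + \<gamma> \<in> A\<rbrakk> \<Longrightarrow> (\<beta>, \<gamma>) \<in> R"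
    and "\<And>\<beta> \<gamma> \<beta>' \<gamma>'. \<lbrakk>(\<beta>, \<gamma>) \<in> R; \<beta>' \<in> B; \<gamma>' \<in> B; \<beta>' + \<gamma>' = \<beta> + \<gamma>\<rbrakk> \<Longrightarrow> (\<beta>', \<gamma>') \<in> R"
proof -
  obtain N where N: "\<And>k. k \<ge> N \<Longrightarrow> B_iter A B k = B_stable A B"
    using B_stable_eventually[OF assms] by (auto simp: eventually_sequentially)
  define R where "R = B_supp A B N"
  have stable: "B_stable A B = (\<lambda>\<beta> \<gamma>. of_bool ((\<beta>, \<gamma>) \<in> R))"
    using N[of "Suc N"] by (simp add: B_iter_Suc R_def)
  \<comment> \<open>\<open>B_iter\<close> runs one index ahead of \<open>B_supp\<close>, so this
    compares the stable matrix at \<open>Suc N\<close> and \<open>Suc (Suc N)\<close>.\<close>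
  have Suc: "B_supp A B (Suc N) = R"
  proof -
    have "(of_bool ((\<beta>, \<gamma>) \<in> B_supp A B (Suc N)) :: real) = of_bool ((\<beta>, \<gamma>) \<in> R)" for \<beta> \<gamma>
      using stable N[of "Suc (Suc N)"] B_iter_Suc[of A B "Suc N"] by (metis le_SucI order_refl)
    then show ?thesis by (auto simp: of_bool_eq_iff)
  qed
  show thesis
  proof
    show "equiv B R" unfolding R_def by (rule B_supp_equiv)
    fix \<beta> \<gamma>
    \<comment> \<open>\<open>A\<close> enters explicitly only at index 0; monotonicity carries its
      pairs on to \<open>N\<close>.\<close>
    have "B_supp A B 0 \<subseteq> R"
      unfolding R_def by (rule B_supp_0_subset)
    then show "(\<beta>, \<gamma>) \<in> R" if "\<beta> \<in> B" "\<gamma> \<in> B" "\<beta> + \<gamma> \<in> A"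
      using that B_suppI[of \<beta> B \<gamma> A 0] by auto
    fix \<beta>' \<gamma>'
    show "(\<beta>', \<gamma>') \<in> R"
      if "(\<beta>, \<gamma>) \<in> R" "\<beta>' \<in> B" "\<gamma>' \<in> B" "\<beta>' + \<gamma>' = \<beta> + \<gamma>"
    proof -
      \<comment> \<open>The sum of a pair in \<open>R\<close> belongs to the next support set, which
        makes every pair with that sum adjacent one step later, where the closure is still
        \<open>R\<close>.\<close>
      have "\<beta>' + \<gamma>' \<in> S_iter A B (Suc N)"
        using that unfolding S_iter_Suc R_def by auto
      with that show ?thesis using B_suppI Suc by blast
    qed
  qed (rule stable)
qed

lemma gram_poly_hadamard:
  assumes supp: "gram_poly B Q \<in> polys_on A"
    and A: "\<And>\<beta> \<gamma>. \<lbrakk>\<beta> \<in> B; \<gamma> \<in> B; \<beta> + \<gamma> \<in> A\<rbrakk> \<Longrightarrow> (\<beta>, \<gamma>) \<in> R"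
    and sum_closed: "\<And>\<beta> \<gamma> \<beta>' \<gamma>'.
      \<lbrakk>(\<beta>, \<gamma>) \<in> R; \<beta>' \<in> B; \<gamma>' \<in> B; \<beta>' + \<gamma>' = \<beta> + \<gamma>\<rbrakk> \<Longrightarrow> (\<beta>', \<gamma>') \<in> R"
  shows "gram_poly B (hadamard (\<lambda>\<beta> \<gamma>. of_bool ((\<beta>, \<gamma>) \<in> R)) Q) = gram_poly B Q"
    (is "gram_poly B ?H = _")
proof (rule poly_mapping_eqI)
  fix \<alpha>
  show "Poly_Mapping.lookup (gram_poly B ?H) \<alpha> = Poly_Mapping.lookup (gram_poly B Q) \<alpha>"
  \<comment> \<open>In the first case the mask erases no entry contributing to \<alpha>. In the
    second it erases all of them, and the support condition gives coefficient 0 for \<open>Q\<close>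
    as well.\<close>
  proof (cases "\<alpha> \<in> A \<or> (\<exists>(\<beta>, \<gamma>) \<in> R. \<beta> + \<gamma> = \<alpha>)")
    case True
    then have "(\<beta>, \<gamma>) \<in> R" if "\<beta> \<in> B" "\<gamma> \<in> B" "\<beta> + \<gamma> = \<alpha>" for \<beta> \<gamma>
      using that A sum_closed by blast
    then show ?thesis
      unfolding lookup_gram_poly hadamard_def by (intro sum.cong) auto
  next
    case False
    then have "Poly_Mapping.lookup (gram_poly B Q) \<alpha> = 0"
      using supp by (auto simp: polys_on_def in_keys_iff)
    moreover have "Poly_Mapping.lookup (gram_poly B ?H) \<alpha> = 0"
      unfolding lookup_gram_poly hadamard_def using False by (intro sum.neutral ballI) auto
    ultimately show ?thesis by simp
  qed
qed

theorem theorem3p3: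
  fixes A B :: "(nat ^ 'n::finite) set"
  assumes "finite A"
    and "monomial_basis A B"
  shows "Sigma_star A B = Sigma_full A B"
proof
  show "Sigma_star A B \<subseteq> Sigma_full A B"
    by (auto simp: Sigma_star_def Sigma_full_def psd_matrices_pattern_def)
  have "finite B" using assms(2) by (simp add: monomial_basis_def)
  then obtain R where R: "B_stable A B = (\<lambda>\<beta> \<gamma>. of_bool ((\<beta>, \<gamma>) \<in> R))" "equiv B R"
    and A: "\<And>\<beta> \<gamma>. \<lbrakk>\<beta> \<in> B; \<gamma> \<in> B; \<beta> + \<gamma> \<in> A\<rbrakk> \<Longrightarrow> (\<beta>, \<gamma>) \<in> R"
    and sum_closed: "\<And>\<beta> \<gamma> \<beta>' \<gamma>'.
      \<lbrakk>(\<beta>, \<gamma>) \<in> R; \<beta>' \<in> B; \<gamma>' \<in> B; \<beta>' + \<gamma>' = \<beta> + \<gamma>\<rbrakk> \<Longrightarrow> (\<beta>', \<gamma>') \<in> R"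
    by (rule B_stable_obtain_equiv[of B A]) blast
  show "Sigma_full A B \<subseteq> Sigma_star A B"
  proof
    fix f assume "f \<in> Sigma_full A B"
    then obtain Q where f: "f \<in> polys_on A" and Q: "Q \<in> psd_matrices B" "f = gram_poly B Q"
      by (auto simp: Sigma_full_def)
    let ?H = "hadamard (B_stable A B) Q"
    have "?H \<in> psd_matrices B"
      unfolding R(1) using \<open>finite B\<close> R(2) Q(1) by (rule hadamard_equiv_psd)
    moreover have "hadamard (B_stable A B) ?H = ?H"
      by (simp add: R(1) hadamard_def fun_eq_iff)
    moreover have "gram_poly B ?H = f"
      using f Q(2) gram_poly_hadamard[where Q = Q, OF _ A sum_closed] by (simp add: R(1))
    ultimately show "f \<in> Sigma_star A B"
      using f by (auto simp: Sigma_star_def psd_matrices_pattern_def)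
  qed
qed

end
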